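(* For all even integers $n\geq 4$ the sets $\{2\}$ and $\{n-1\}$, which are minimal driver sets for the path graph $P_n$, are of type II.
   Context: $P_n$ is the simple undirected path graph with vertex set $V=\{1,\ldots,n\}$ and edge set $\{\{1,2\},\{2,3\},\ldots,\{n-1,n\}\}$. For a simple undirected graph $G=(V,E)$ on $V=\{1,\ldots,n\}$ with (0-1) adjacency matrix $A$ and a non-empty subset $S=\{i_1,\ldots,i_k\}\subseteq V$, $B_S$ denotes the $(n\times k)$-matrix with columns the standard basis vectors $\mathbf{e}_{i_1},\ldots,\mathbf{e}_{i_k}$. A pair $(X,B)$ is controllable if the linear system $\dot{\mathbf{x}}=X\mathbf{x}+B\mathbf{u}$ is controllable. $S$ is a driver set for $G$ if $(A,B_S)$ is controllable; a minimal driver set is a driver set of minimum cardinality. $\mathrm{Sym}(G)$ is the set of all real symmetric $(n\times n)$-matrices $X=[x_{ij}]$ such that for all $i\neq j$: $x_{ij}\neq 0$ if and only if $\{i,j\}\in E$ (the diagonal entries are free). $\mathrm{Sym}_0(G)$ is the subset of matrices in $\mathrm{Sym}(G)$ all of whose diagonal entries are zero. For a set $F$ of matrices, $(G,S)$ is strongly $F$-controllable if $(X,B_S)$ is controllable for all $X\in F$. A driver set $S$ is of type II if $(G,S)$ is strongly $\mathrm{Sym}_0(G)$-controllable but not strongly $\mathrm{Sym}(G)$-controllable. *)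

theory Defs
  imports "HOL-Analysis.Analysis" "Jordan_Normal_Form.Matrix"
begin

text \<open>
  A simple graph on the vertex set \<open>{1..n}\<close> is given by \<open>n\<close> and its set of two-element edges.
  Vertices are counted from 1, whereas matrix and vector entries are indexed from 0; vertex \<open>i\<close>
  belongs to index \<open>i - 1\<close>.
\<close>

type_synonym edges = "nat set set"

definition path_edges :: "nat \<Rightarrow> edges" where
  "path_edges n = {{i, i + 1} | i. 1 \<le> i \<and> i + 1 \<le> n}"

definition adj_matrix :: "nat \<Rightarrow> edges \<Rightarrow> real Matrix.mat" where
  "adj_matrix n E = Matrix.mat n n (\<lambda>(i, j). if {i + 1, j + 1} \<in> E then 1 else 0)"

definition input_matrix :: "nat \<Rightarrow> nat set \<Rightarrow> real Matrix.mat" where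
  "input_matrix n S = mat_of_cols n (map (\<lambda>i. unit_vec n (i - 1)) (sorted_list_of_set S))"

text \<open>
  \<open>x\<close> is the state trajectory on \<open>[0,T]\<close> of the system \<open>x' = X x + B u\<close> driven by the input \<open>u\<close>.
  Inputs are Lebesgue integrable, and the differential equation is understood in the sense
  of Caratheodory, that is, in integrated form; for continuous inputs this is the classical notion.
\<close>

definition trajectory ::
  "real Matrix.mat \<Rightarrow> real Matrix.mat \<Rightarrow> real \<Rightarrow> (real \<Rightarrow> real Matrix.vec) \<Rightarrow> (real \<Rightarrow> real Matrix.vec) \<Rightarrow> bool"
  where
  "trajectory X B T u x \<longleftrightarrow>
     (\<forall>t\<in>{0..T}. u t \<in> carrier_vec (dim_col B)) \<and>
     (\<forall>j<dim_col B. (\<lambda>t. vec_index (u t) j) absolutely_integrable_on {0..T}) \<and>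
     (\<forall>t\<in>{0..T}. x t \<in> carrier_vec (dim_row X)) \<and>
     (\<forall>i<dim_row X. continuous_on {0..T} (\<lambda>t. vec_index (x t) i)) \<and>
     (\<forall>i<dim_row X. \<forall>t\<in>{0..T}.
        ((\<lambda>s. vec_index (X *\<^sub>v x s + B *\<^sub>v u s) i) has_integral
           (vec_index (x t) i - vec_index (x 0) i)) {0..t})"

definition controllable :: "real Matrix.mat \<Rightarrow> real Matrix.mat \<Rightarrow> bool" where
  "controllable X B \<longleftrightarrow>
     (\<forall>x0\<in>carrier_vec (dim_row X). \<forall>x1\<in>carrier_vec (dim_row X).
        \<exists>T>0. \<exists>u x. trajectory X B T u x \<and> x 0 = x0 \<and> x T = x1)"

definition driver_set :: "nat \<Rightarrow> edges \<Rightarrow> nat set \<Rightarrow> bool" where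
  "driver_set n E S \<longleftrightarrow>
     S \<noteq> {} \<and> S \<subseteq> {1..n} \<and> controllable (adj_matrix n E) (input_matrix n S)"

definition minimal_driver_set :: "nat \<Rightarrow> edges \<Rightarrow> nat set \<Rightarrow> bool" where
  "minimal_driver_set n E S \<longleftrightarrow>
     driver_set n E S \<and> (\<forall>S'. driver_set n E S' \<longrightarrow> card S \<le> card S')"

definition Sym :: "nat \<Rightarrow> edges \<Rightarrow> real Matrix.mat set" where
  "Sym n E = {X \<in> carrier_mat n n. transpose_mat X = X \<and>
     (\<forall>i\<in>{1..n}. \<forall>j\<in>{1..n}. i \<noteq> j \<longrightarrow> (X $$ (i - 1, j - 1) \<noteq> 0 \<longleftrightarrow> {i, j} \<in> E))}"

definition Sym0 :: "nat \<Rightarrow> edges \<Rightarrow> real Matrix.mat set" where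
  "Sym0 n E = {X \<in> Sym n E. \<forall>i\<in>{1..n}. X $$ (i - 1, i - 1) = 0}"

definition strongly_controllable :: "real Matrix.mat set \<Rightarrow> nat \<Rightarrow> nat set \<Rightarrow> bool" where
  "strongly_controllable F n S \<longleftrightarrow> (\<forall>X\<in>F. controllable X (input_matrix n S))"

definition type_II :: "nat \<Rightarrow> edges \<Rightarrow> nat set \<Rightarrow> bool" where
  "type_II n E S \<longleftrightarrow>
     driver_set n E S \<and>
     strongly_controllable (Sym0 n E) n S \<and> \<not> strongly_controllable (Sym n E) n S"

end

theory Submission
  imports Defs
begin

text \<open>
  Controllability at the vertex \<open>n - 1\<close> is shown by differential flatness. Let \<open>w k\<close> be the weight
  of the edge between the indices \<open>k\<close> and \<open>k + 1\<close>. If the state at index \<open>0\<close> is \<open>y'\<close>, the equations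
  of the uncontrolled indices force the state at index \<open>k\<close>, for \<open>k \<le> n - 2\<close>, to be \<open>P k (d/dt) y'\<close>
  with \<open>P k\<close> of degree \<open>k\<close>, and the last state can be taken to be a multiple of
  \<open>P (n - 2) (d/dt) y\<close>. Since the diagonal vanishes and \<open>n - 2\<close> is even, \<open>P (n - 2)\<close> has a nonzero
  constant term. Hence arbitrary initial and final states correspond to prescribed derivatives of
  \<open>y\<close> of order less than \<open>n\<close> at \<open>0\<close> and \<open>1\<close>, which a Hermite interpolation polynomial attains.
  With a free diagonal one can instead arrange a kernel vector that vanishes at the input vertex,
  and its inner product with the state is then conserved. Reversing the path gives the vertex \<open>2\<close>.
\<close>

section \<open>Hermite interpolation at two points\<close>

text \<open>Each differentiation lowers the exponent of the root factor by one and multiplies the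
  cofactor's value at \<open>c\<close> by the old exponent. The cofactor itself changes, hence the
  induction over arbitrary \<open>q\<close>.\<close>

lemma higher_pderiv_root_power:
  fixes q :: "real poly"
  assumes "i \<le> N"
  shows "poly ((pderiv ^^ i) ([:-c, 1:] ^ N * q)) c = (if i = N then fact N * poly q c else 0)"
  using assms
proof (induction N arbitrary: q i)
  case 0
  then show ?case by simp
next
  case (Suc N)
  have step: "pderiv ([:-c, 1:] ^ Suc N * q)
      = [:-c, 1:] ^ N * (Polynomial.smult (of_nat (Suc N)) q + [:-c, 1:] * pderiv q)"
    by (simp only: pderiv_mult pderiv_power_Suc)
       (simp add: pderiv_pCons algebra_simps)
  show ?case
  proof (cases i)
    case 0
    then show ?thesis by simp
  next
    case (Suc j)
    with Suc.prems have "j \<le> N" by simp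
    from Suc.IH[OF this, of "Polynomial.smult (of_nat (Suc N)) q + [:-c, 1:] * pderiv q"]
    have "poly ((pderiv ^^ j) (pderiv ([:-c, 1:] ^ Suc N * q))) c
        = (if j = N then fact N * (of_nat (Suc N) * poly q c) else 0)"
      unfolding step by simp
    moreover have "(pderiv ^^ i) ([:-c, 1:] ^ Suc N * q)
        = (pderiv ^^ j) (pderiv ([:-c, 1:] ^ Suc N * q))"
      unfolding Suc funpow_Suc_right by simp
    ultimately show ?thesis using Suc by (simp add: algebra_simps)
  qed
qed

text \<open>Induction on the number of prescribed derivatives: a correction with zeros of order
  \<open>N\<close> at both points keeps the earlier values, and its linear cofactor has two
  coefficients for the two new ones.\<close>

lemma hermite_interpolation:
  fixes a b :: "nat \<Rightarrow> real"
  shows "\<exists>y :: real poly. \<forall>i<N. poly ((pderiv ^^ i) y) 0 = a i \<and> poly ((pderiv ^^ i) y) 1 = b i"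
proof (induction N)
  case 0
  then show ?case by simp
next
  case (Suc N)
  then obtain y :: "real poly" where
    y: "poly ((pderiv ^^ i) y) 0 = a i" "poly ((pderiv ^^ i) y) 1 = b i" if "i < N" for i
    by blast
  \<comment> \<open>The derivative of order \<open>N\<close> of the correction \<open>r\<close>
    below is \<open>fact N * (- 1) ^ N * \<alpha>\<close> at \<open>0\<close> and
    \<open>fact N * (\<alpha> + \<beta>)\<close> at \<open>1\<close>; these two equations are solved
    here.\<close>
  define \<alpha> where "\<alpha> = (a N - poly ((pderiv ^^ N) y) 0) / (fact N * (- 1) ^ N)"
  define \<beta> where "\<beta> = (b N - poly ((pderiv ^^ N) y) 1) / fact N - \<alpha>"
  define r where "r = [:0, 1:] ^ N * ([:-1, 1:] ^ N * [:\<alpha>, \<beta>:])"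
  have r': "r = [:-1, 1:] ^ N * ([:0, 1:] ^ N * [:\<alpha>, \<beta>:])"
    unfolding r_def by (rule mult.left_commute)
  have r0: "poly ((pderiv ^^ i) r) 0 = (if i = N then fact N * ((- 1) ^ N * \<alpha>) else 0)"
    if "i \<le> N" for i
    using higher_pderiv_root_power[OF that, of 0] by (simp add: r_def)
  have r1: "poly ((pderiv ^^ i) r) 1 = (if i = N then fact N * (\<alpha> + \<beta>) else 0)" if "i \<le> N" for i
    using higher_pderiv_root_power[OF that, of 1] by (simp add: r')
  have "poly ((pderiv ^^ i) (y + r)) 0 = a i \<and> poly ((pderiv ^^ i) (y + r)) 1 = b i"
    if "i < Suc N" for i
  proof (cases "i = N")
    case True
    then show ?thesis
      by (simp add: higher_pderiv_add r0 r1 \<beta>_def) (simp add: \<alpha>_def)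
  next
    case False
    with that show ?thesis by (simp add: higher_pderiv_add r0 r1 y)
  qed
  then show ?case by blast
qed

section \<open>Polynomials in the derivative\<close>

definition diff_op :: "real poly \<Rightarrow> real poly \<Rightarrow> real poly" where
  "diff_op p y = (\<Sum>i\<le>degree p. Polynomial.smult (coeff p i) ((pderiv ^^ i) y))"

lemma pderiv_sum:
  fixes f :: "'b \<Rightarrow> real poly"
  shows "pderiv (\<Sum>i\<in>I. f i) = (\<Sum>i\<in>I. pderiv (f i))"
  using higher_pderiv_sum[of 1 f I] by simp

lemma smult_sum_right: "Polynomial.smult c (\<Sum>i\<in>I. f i) = (\<Sum>i\<in>I. Polynomial.smult c (f i))"
  by (induction I rule: infinite_finite_induct) (simp_all add: smult_add_right)

lemma diff_op_atMost:
  assumes "degree p \<le> N"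
  shows "diff_op p y = (\<Sum>i\<le>N. Polynomial.smult (coeff p i) ((pderiv ^^ i) y))"
  unfolding diff_op_def
  by (rule sum.mono_neutral_left) (use assms in \<open>auto simp: coeff_eq_0\<close>)

lemma diff_op_diff: "diff_op (p - q) y = diff_op p y - diff_op q y"
proof -
  define N where "N = max (degree p) (degree q)"
  have "degree p \<le> N" "degree q \<le> N" "degree (p - q) \<le> N"
    by (auto simp: N_def degree_diff_le_max)
  then show ?thesis
    by (simp add: diff_op_atMost[of _ N] smult_diff_left sum_subtractf)
qed

lemma diff_op_smult: "diff_op (Polynomial.smult c p) y = Polynomial.smult c (diff_op p y)"
  using diff_op_atMost[OF degree_smult_le, of c p y]
  by (simp add: diff_op_def smult_sum_right)

text \<open>Together with linearity this turns the recursion of \<open>chain_poly\<close> into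
  differential equations.\<close>

lemma diff_op_pCons_0: "diff_op (pCons 0 p) y = pderiv (diff_op p y)"
proof -
  have "diff_op (pCons 0 p) y
      = (\<Sum>i\<le>Suc (degree p). Polynomial.smult (coeff (pCons 0 p) i) ((pderiv ^^ i) y))"
    by (rule diff_op_atMost) (simp add: degree_pCons_le)
  also have "\<dots> = pderiv (diff_op p y)"
    by (subst sum.atMost_Suc_shift) (simp add: diff_op_def pderiv_sum pderiv_smult)
  finally show ?thesis .
qed

lemma diff_op_pderiv: "diff_op p (pderiv y) = pderiv (diff_op p y)"
  by (simp add: diff_op_def pderiv_sum pderiv_smult funpow_swap1)

lemma diff_op_1: "diff_op 1 y = y"
  by (simp add: diff_op_def)

section \<open>Steering a zero-diagonal chain from its second-last index\<close>

text \<open>Row \<open>Suc k\<close> of a zero-diagonal chain, solved for the state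
  \<open>Suc (Suc k)\<close>, with the indeterminate in place of d/dt. For nonzero weights these
  are, up to nonzero factors, the characteristic polynomials of the leading blocks.\<close>

fun chain_poly :: "(nat \<Rightarrow> real) \<Rightarrow> nat \<Rightarrow> real poly" where
  "chain_poly w 0 = 1"
| "chain_poly w (Suc 0) = Polynomial.smult (1 / w 0) (pCons 0 1)"
| "chain_poly w (Suc (Suc k)) =
     Polynomial.smult (1 / w (Suc k)) (pCons 0 (chain_poly w (Suc k)) - Polynomial.smult (w k) (chain_poly w k))"

lemma degree_chain_poly:
  assumes "\<And>k. w k \<noteq> 0"
  shows "degree (chain_poly w k) = k"
proof (induction k rule: induct_nat_012)
  case (ge2 k)
  have "chain_poly w (Suc k) \<noteq> 0" using ge2 by auto
  with ge2 have "degree (pCons 0 (chain_poly w (Suc k))) = Suc (Suc k)" by simp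
  moreover have "degree (Polynomial.smult (w k) (chain_poly w k)) < Suc (Suc k)"
    using ge2 degree_smult_le[of "w k" "chain_poly w k"] by linarith
  ultimately have
    "degree (pCons 0 (chain_poly w (Suc k)) + - Polynomial.smult (w k) (chain_poly w k)) = Suc (Suc k)"
    by (subst degree_add_eq_left) auto
  then show ?case using assms by simp
qed (use assms in auto)

text \<open>Constant terms obey a two-step recursion with ratio \<open>- w k / w (Suc k)\<close>,
  starting from \<open>1\<close>. This is where parity enters.\<close>

lemma coeff_0_chain_poly:
  assumes "\<And>k. w k \<noteq> 0"
  shows "even k \<Longrightarrow> coeff (chain_poly w k) 0 \<noteq> 0"
  by (induction k rule: induct_nat_012) (use assms in auto)

lemma triangular_system:
  fixes c :: "nat \<Rightarrow> nat \<Rightarrow> real"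
  assumes "\<And>k. c k k \<noteq> 0"
  shows "\<exists>e. \<forall>k<m. (\<Sum>i\<le>k. c k i * e i) = a k"
proof (induction m)
  case 0
  then show ?case by simp
next
  case (Suc m)
  then obtain e where e: "(\<Sum>i\<le>k. c k i * e i) = a k" if "k < m" for k by blast
  \<comment> \<open>The new unknown solves equation \<open>m\<close> and occurs in none of the
    earlier ones.\<close>
  define e' where "e' = e(m := (a m - (\<Sum>i<m. c m i * e i)) / c m m)"
  have "(\<Sum>i\<le>k. c k i * e' i) = a k" if "k < Suc m" for k
  proof (cases "k = m")
    case True
    have "(\<Sum>i<m. c m i * e' i) = (\<Sum>i<m. c m i * e i)"
      by (rule sum.cong) (auto simp: e'_def)
    then show ?thesis
      using True assms[of m] by (simp add: lessThan_Suc_atMost[symmetric] e'_def)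
  next
    case False
    have "(\<Sum>i\<le>k. c k i * e' i) = (\<Sum>i\<le>k. c k i * e i)"
      by (rule sum.cong) (use that False in \<open>auto simp: e'_def\<close>)
    then show ?thesis using e that False by simp
  qed
  then show ?case by blast
qed

lemma sum_neighbours:
  fixes f :: "nat \<Rightarrow> 'a::comm_monoid_add"
  assumes "i < n" and "\<And>j. j < n \<Longrightarrow> j \<noteq> i \<Longrightarrow> j \<noteq> Suc i \<Longrightarrow> i \<noteq> Suc j \<Longrightarrow> f j = 0"
  shows "(\<Sum>j<n. f j) = (if i = 0 then 0 else f (i - 1)) + f i + (if Suc i < n then f (Suc i) else 0)"
proof -
  have "(\<Sum>j<n. f j) = (\<Sum>j\<in>{i - 1, i, Suc i} \<inter> {..<n}. f j)"
  proof (rule sum.mono_neutral_right)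
    show "\<forall>j\<in>{..<n} - {i - 1, i, Suc i} \<inter> {..<n}. f j = 0"
      by (intro ballI assms(2)) auto
  qed auto
  \<comment> \<open>Truncated subtraction gives \<open>i - 1 = i\<close> at \<open>i = 0\<close>, so
    the left neighbour needs a case split.\<close>
  also have "{i - 1, i, Suc i} \<inter> {..<n}
      = (if i = 0 then {} else {i - 1}) \<union> {i} \<union> (if Suc i < n then {Suc i} else {})"
    using assms(1) by auto
  finally have "(\<Sum>j<n. f j)
      = sum f ((if i = 0 then {} else {i - 1}) \<union> {i} \<union> (if Suc i < n then {Suc i} else {}))" .
  also have "\<dots> = sum f (if i = 0 then {} else {i - 1}) + sum f {i}
      + sum f (if Suc i < n then {Suc i} else {})"
    by (subst sum.union_disjoint, simp, simp, force)+ simp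
  finally show ?thesis by auto
qed

text \<open>Polynomial states and inputs make the differential equation a polynomial identity; the
  time horizon is fixed to \<open>[0, 1]\<close>.\<close>

definition poly_steerable :: "nat \<Rightarrow> (nat \<Rightarrow> nat \<Rightarrow> real) \<Rightarrow> nat \<Rightarrow> bool" where
  "poly_steerable n A m \<longleftrightarrow>
     (\<forall>a b. \<exists>(z :: nat \<Rightarrow> real poly) u.
        (\<forall>i<n. pderiv (z i) = (\<Sum>j<n. Polynomial.smult (A i j) (z j)) + (if i = m then u else 0)) \<and>
        (\<forall>i<n. poly (z i) 0 = a i \<and> poly (z i) 1 = b i))"

text \<open>The equivalence at \<open>i = j\<close> is what forces the diagonal to vanish.\<close>

definition zero_diag_chain :: "nat \<Rightarrow> (nat \<Rightarrow> nat \<Rightarrow> real) \<Rightarrow> bool" where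
  "zero_diag_chain n A \<longleftrightarrow>
     (\<forall>i<n. \<forall>j<n. A i j = A j i \<and> (A i j \<noteq> 0 \<longleftrightarrow> j = Suc i \<or> i = Suc j))"

text \<open>Here \<open>d i\<close> stands for the \<open>i\<close>-th derivative of
  \<open>y\<close> at an endpoint and \<open>a\<close> for the state there. States up to
  \<open>m\<close> involve only \<open>d 1\<close>, ..., \<open>d (Suc m)\<close>, through a
  triangular system with the leading coefficients on its diagonal. The last state alone involves
  \<open>d 0\<close>, whose coefficient is nonzero because \<open>m\<close> is even.\<close>

lemma chain_jet:
  assumes w: "\<And>k. w k \<noteq> 0" and "even m"
  shows "\<exists>d. (\<forall>k\<le>m. (\<Sum>i\<le>k. coeff (chain_poly w k) i * d (Suc i)) = a k) \<and>
             w m * (\<Sum>i\<le>m. coeff (chain_poly w m) i * d i) = a (Suc m)"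
proof -
  have "coeff (chain_poly w k) k \<noteq> 0" for k
  proof (cases "k = 0")
    case False
    then have "chain_poly w k \<noteq> 0" using degree_chain_poly[of w k] w by auto
    then show ?thesis using degree_chain_poly[of w k] w leading_coeff_neq_0 by metis
  qed simp
  from triangular_system[where c = "\<lambda>k. coeff (chain_poly w k)", OF this]
  obtain e where e: "(\<Sum>i\<le>k. coeff (chain_poly w k) i * e i) = a k" if "k < Suc m" for k
    by blast
  define d0 where
    "d0 = (a (Suc m) / w m - (\<Sum>i<m. coeff (chain_poly w m) (Suc i) * e i)) / coeff (chain_poly w m) 0"
  have "(\<Sum>i\<le>m. coeff (chain_poly w m) i * case_nat d0 e i)
      = coeff (chain_poly w m) 0 * d0 + (\<Sum>i<m. coeff (chain_poly w m) (Suc i) * e i)"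
    by (cases m) (simp_all add: sum.atMost_Suc_shift lessThan_Suc_atMost del: sum.atMost_Suc)
  then have "w m * (\<Sum>i\<le>m. coeff (chain_poly w m) i * case_nat d0 e i) = a (Suc m)"
    using coeff_0_chain_poly[OF w \<open>even m\<close>] w[of m] by (simp add: d0_def)
  with e show ?thesis by (intro exI[of _ "case_nat d0 e"]) auto
qed

lemma poly_steerable_second_last:
  assumes chain: "zero_diag_chain n A" and "even n" "n \<ge> 2"
  shows "poly_steerable n A (n - 2)"
  unfolding poly_steerable_def
proof (intro allI)
  fix a b :: "nat \<Rightarrow> real"
  obtain m where n: "n = Suc (Suc m)" using \<open>n \<ge> 2\<close> by (metis add_2_eq_Suc le_Suc_ex)
  with \<open>even n\<close> have "even m" by simp
  \<comment> \<open>The value \<open>1\<close> beyond the path keeps all weights nonzero.\<close>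
  define w where "w k = (if Suc k < n then A k (Suc k) else 1)" for k
  have w: "w k \<noteq> 0" for k
    using chain by (auto simp: w_def zero_diag_chain_def)
  obtain d0 where d0: "\<And>k. k \<le> m \<Longrightarrow> (\<Sum>i\<le>k. coeff (chain_poly w k) i * d0 (Suc i)) = a k"
      "w m * (\<Sum>i\<le>m. coeff (chain_poly w m) i * d0 i) = a (Suc m)"
    using chain_jet[of w m a, OF w \<open>even m\<close>] by blast
  obtain d1 where d1: "\<And>k. k \<le> m \<Longrightarrow> (\<Sum>i\<le>k. coeff (chain_poly w k) i * d1 (Suc i)) = b k"
      "w m * (\<Sum>i\<le>m. coeff (chain_poly w m) i * d1 i) = b (Suc m)"
    using chain_jet[of w m b, OF w \<open>even m\<close>] by blast
  \<comment> \<open>The states involve derivatives of \<open>y\<close> of order at most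
    \<open>Suc m = n - 1\<close>.\<close>
  obtain y :: "real poly" where
    y: "poly ((pderiv ^^ i) y) 0 = d0 i" "poly ((pderiv ^^ i) y) 1 = d1 i" if "i < n" for i
    using hermite_interpolation[of n d0 d1] by blast
  \<comment> \<open>The last equation says that the derivative of \<open>z (Suc m)\<close> is
    \<open>w m\<close> times \<open>z m\<close>. Since \<open>z m\<close> is an operator applied to
    \<open>pderiv y\<close>, applying the operator to \<open>y\<close> instead integrates
    it.\<close>
  define z where "z k = (if k \<le> m then diff_op (chain_poly w k) (pderiv y)
    else Polynomial.smult (w m) (diff_op (chain_poly w m) y))" for k
  \<comment> \<open>The input is whatever equation \<open>m\<close> lacks.\<close>
  define u where "u = pderiv (z m) - (\<Sum>j<n. Polynomial.smult (A m j) (z j))"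
  have chain_sum: "(\<Sum>j<n. Polynomial.smult (A i j) (z j)) =
      (if i = 0 then 0 else Polynomial.smult (w (i - 1)) (z (i - 1))) +
      (if Suc i < n then Polynomial.smult (w i) (z (Suc i)) else 0)" if "i < n" for i
  proof -
    have "A i i = 0" using chain that unfolding zero_diag_chain_def by (metis n_not_Suc_n)
    moreover have "i \<noteq> 0 \<Longrightarrow> A i (i - 1) = w (i - 1)"
      using chain that by (auto simp: zero_diag_chain_def w_def)
    moreover have "(\<Sum>j<n. Polynomial.smult (A i j) (z j)) = (if i = 0 then 0 else Polynomial.smult (A i (i - 1)) (z (i - 1)))
        + Polynomial.smult (A i i) (z i) + (if Suc i < n then Polynomial.smult (A i (Suc i)) (z (Suc i)) else 0)"
      by (rule sum_neighbours[OF that]) (use chain that in \<open>auto simp: zero_diag_chain_def\<close>)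
    ultimately show ?thesis by (simp add: w_def)
  qed
  have ode: "pderiv (z i) = (\<Sum>j<n. Polynomial.smult (A i j) (z j)) + (if i = m then u else 0)"
    if i: "i < n" for i
  proof -
    consider "i = m" | "i = Suc m" | "i < m" using i n by linarith
    then show ?thesis
    proof cases
      case 1
      then show ?thesis by (simp add: u_def)
    next
      case 2
      then show ?thesis
        using chain_sum[OF i] by (simp add: n z_def diff_op_pderiv pderiv_smult)
    next
      \<comment> \<open>Row \<open>i\<close> is the defining recursion of
        \<open>chain_poly w (Suc i)\<close>, applied to \<open>pderiv y\<close>.\<close>
      case 3
      then show ?thesis
        unfolding chain_sum[OF i] using w
        by (cases i) (simp_all add: n z_def diff_op_smult diff_op_diff diff_op_pCons_0 diff_op_1
            del: smult_pCons)
    qed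
  qed
  have poly_z: "poly (z i) t = (if i \<le> m
      then (\<Sum>j\<le>i. coeff (chain_poly w i) j * poly ((pderiv ^^ Suc j) y) t)
      else w m * (\<Sum>j\<le>m. coeff (chain_poly w m) j * poly ((pderiv ^^ j) y) t))" for i t
    by (simp add: z_def diff_op_def degree_chain_poly[OF w] poly_sum funpow_swap1)
  have "poly (z i) 0 = a i \<and> poly (z i) 1 = b i" if "i < n" for i
  proof (cases "i \<le> m")
    case True
    have "poly ((pderiv ^^ Suc j) y) 0 = d0 (Suc j)" "poly ((pderiv ^^ Suc j) y) 1 = d1 (Suc j)"
      if "j \<le> i" for j
      using y[of "Suc j"] that True n by auto
    then show ?thesis
      using True d0(1) d1(1) unfolding poly_z by (simp del: funpow.simps)
  next
    case False
    with that n have "i = Suc m" by simp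
    then show ?thesis
      using d0(2) d1(2) y n unfolding poly_z by simp
  qed
  with ode show "\<exists>z u. (\<forall>i<n. pderiv (z i) = (\<Sum>j<n. Polynomial.smult (A i j) (z j))
      + (if i = n - 2 then u else 0)) \<and> (\<forall>i<n. poly (z i) 0 = a i \<and> poly (z i) 1 = b i)"
    using n by (intro exI[of _ z] exI[of _ u]) simp
qed

section \<open>Reversal of the index order\<close>

lemma zero_diag_chain_rev:
  assumes "zero_diag_chain n A"
  shows "zero_diag_chain n (\<lambda>i j. A (n - Suc i) (n - Suc j))"
  unfolding zero_diag_chain_def
proof (intro allI impI)
  fix i j assume ij: "i < n" "j < n"
  then have "n - Suc i < n" "n - Suc j < n" by auto
  with assms have "A (n - Suc i) (n - Suc j) = A (n - Suc j) (n - Suc i)"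
    "A (n - Suc i) (n - Suc j) \<noteq> 0 \<longleftrightarrow> n - Suc j = Suc (n - Suc i) \<or> n - Suc i = Suc (n - Suc j)"
    unfolding zero_diag_chain_def by blast+
  moreover have "n - Suc j = Suc (n - Suc i) \<or> n - Suc i = Suc (n - Suc j)
      \<longleftrightarrow> j = Suc i \<or> i = Suc j"
    using ij by auto
  ultimately show "A (n - Suc i) (n - Suc j) = A (n - Suc j) (n - Suc i) \<and>
      (A (n - Suc i) (n - Suc j) \<noteq> 0 \<longleftrightarrow> j = Suc i \<or> i = Suc j)"
    by blast
qed

lemma poly_steerable_rev:
  assumes "poly_steerable n (\<lambda>i j. A (n - Suc i) (n - Suc j)) (n - Suc m)" and "m < n"
  shows "poly_steerable n A m"
  unfolding poly_steerable_def
proof (intro allI)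
  fix a b :: "nat \<Rightarrow> real"
  obtain z :: "nat \<Rightarrow> real poly" and u where
    z: "\<And>i. i < n \<Longrightarrow> pderiv (z i) = (\<Sum>j<n. Polynomial.smult (A (n - Suc i) (n - Suc j)) (z j))
        + (if i = n - Suc m then u else 0)"
      "\<And>i. i < n \<Longrightarrow> poly (z i) 0 = a (n - Suc i) \<and> poly (z i) 1 = b (n - Suc i)"
    using assms(1)[unfolded poly_steerable_def, rule_format,
        of "\<lambda>i. a (n - Suc i)" "\<lambda>i. b (n - Suc i)"] by blast
  have "pderiv (z (n - Suc i))
      = (\<Sum>j<n. Polynomial.smult (A i j) (z (n - Suc j))) + (if i = m then u else 0)" if "i < n" for i
  proof -
    have "(\<Sum>j<n. Polynomial.smult (A i (n - Suc j)) (z j)) = (\<Sum>j<n. Polynomial.smult (A i j) (z (n - Suc j)))"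
      by (subst sum.nat_diff_reindex[symmetric]) (auto intro!: sum.cong)
    moreover have "n - Suc i = n - Suc m \<longleftrightarrow> i = m" using that assms(2) by auto
    ultimately show ?thesis using z(1)[of "n - Suc i"] that by simp
  qed
  moreover have "poly (z (n - Suc i)) 0 = a i \<and> poly (z (n - Suc i)) 1 = b i" if "i < n" for i
    using z(2)[of "n - Suc i"] that by simp
  ultimately show "\<exists>z u. (\<forall>i<n. pderiv (z i) = (\<Sum>j<n. Polynomial.smult (A i j) (z j))
      + (if i = m then u else 0)) \<and> (\<forall>i<n. poly (z i) 0 = a i \<and> poly (z i) 1 = b i)"
    by (intro exI[of _ "\<lambda>i. z (n - Suc i)"] exI[of _ u]) simp
qed

section \<open>Single-input systems\<close>

lemma dim_input_matrix [simp]: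
  "dim_col (input_matrix n {m}) = 1" "dim_row (input_matrix n {m}) = n"
  by (simp_all add: input_matrix_def)

lemma single_input_index:
  assumes X: "X \<in> carrier_mat n n" and x: "x \<in> carrier_vec n" and u: "u \<in> carrier_vec 1"
    and "i < n"
  shows "vec_index (X *\<^sub>v x + input_matrix n {m} *\<^sub>v u) i
       = (\<Sum>j<n. X $$ (i, j) * vec_index x j) + (if i = m - 1 then vec_index u 0 else 0)"
proof -
  have "vec_index (X *\<^sub>v x) i = (\<Sum>j<n. X $$ (i, j) * vec_index x j)"
    using X x \<open>i < n\<close> by (auto simp: scalar_prod_def lessThan_atLeast0 intro!: sum.cong)
  moreover have "vec_index (input_matrix n {m} *\<^sub>v u) i = (if i = m - 1 then vec_index u 0 else 0)"
    using u \<open>i < n\<close> by (auto simp: input_matrix_def scalar_prod_def mat_of_cols_def unit_vec_def)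
  ultimately show ?thesis using X \<open>i < n\<close> by simp
qed

text \<open>The fundamental theorem of calculus turns the polynomial identities into the integrated
  equations of \<open>trajectory\<close> with \<open>T = 1\<close>.\<close>

lemma controllable_if_poly_steerable:
  assumes X: "X \<in> carrier_mat n n" and "poly_steerable n (\<lambda>i j. X $$ (i, j)) (m - 1)"
  shows "controllable X (input_matrix n {m})"
  unfolding controllable_def
proof (intro ballI)
  fix x0 x1 :: "real Matrix.vec"
  assume x01: "x0 \<in> carrier_vec (dim_row X)" "x1 \<in> carrier_vec (dim_row X)"
  obtain z :: "nat \<Rightarrow> real poly" and u where
    z: "\<And>i. i < n \<Longrightarrow> pderiv (z i) = (\<Sum>j<n. Polynomial.smult (X $$ (i, j)) (z j))
        + (if i = m - 1 then u else 0)"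
      "\<And>i. i < n \<Longrightarrow> poly (z i) 0 = vec_index x0 i \<and> poly (z i) 1 = vec_index x1 i"
    using assms(2)[unfolded poly_steerable_def, rule_format,
        of "vec_index x0" "vec_index x1"] by blast
  define x where "x t = Matrix.vec n (\<lambda>i. poly (z i) t)" for t
  define v where "v t = Matrix.vec 1 (\<lambda>_. poly u t)" for t
  have rhs: "vec_index (X *\<^sub>v x s + input_matrix n {m} *\<^sub>v v s) i = poly (pderiv (z i)) s"
    if "i < n" for i s
  proof -
    have "vec_index (X *\<^sub>v x s + input_matrix n {m} *\<^sub>v v s) i
        = (\<Sum>j<n. X $$ (i, j) * vec_index (x s) j) + (if i = m - 1 then vec_index (v s) 0 else 0)"
      by (rule single_input_index) (use X that in \<open>auto simp: x_def v_def\<close>)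
    then show ?thesis using z(1)[OF that] by (simp add: x_def v_def poly_sum)
  qed
  have "((\<lambda>s. vec_index (X *\<^sub>v x s + input_matrix n {m} *\<^sub>v v s) i) has_integral
      (vec_index (x t) i - vec_index (x 0) i)) {0..t}" if "i < n" "t \<in> {0..1}" for i t
  proof -
    have "((\<lambda>s. poly (pderiv (z i)) s) has_integral (poly (z i) t - poly (z i) 0)) {0..t}"
    proof (rule fundamental_theorem_of_calculus)
      show "0 \<le> t" using that by simp
      show "(poly (z i) has_vector_derivative poly (pderiv (z i)) s) (at s within {0..t})" for s
        by (rule has_vector_derivative_at_within)
           (simp add: has_real_derivative_iff_has_vector_derivative[symmetric] poly_DERIV)
    qed
    then show ?thesis using that unfolding rhs[OF that(1)] by (simp add: x_def)
  qed
  moreover have "(\<lambda>t. vec_index (v t) j) absolutely_integrable_on {0..1}" if "j < 1" for j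
    using that by (simp add: v_def absolutely_integrable_continuous_real continuous_on_poly)
  moreover have "continuous_on {0..1} (\<lambda>t. vec_index (x t) i)" if "i < n" for i
    using that by (simp add: x_def continuous_on_poly)
  ultimately have "trajectory X (input_matrix n {m}) 1 v x"
    using X unfolding trajectory_def by (auto simp: x_def v_def)
  moreover have "x 0 = x0" "x 1 = x1"
    using x01 X z(2) by (auto simp: x_def)
  ultimately show "\<exists>T>0. \<exists>u x. trajectory X (input_matrix n {m}) T u x \<and> x 0 = x0 \<and> x T = x1"
    by (intro exI[of _ "1 :: real"] exI[of _ v] exI[of _ x] conjI) simp_all
qed

text \<open>The inner product of \<open>v\<close> with the state is conserved under every input, so
  the origin cannot be steered to the unit vector of index \<open>k\<close>, where this product is
  \<open>v k\<close>.\<close>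

lemma not_controllable_if_left_kernel:
  assumes X: "X \<in> carrier_mat n n"
    and kernel: "\<And>j. j < n \<Longrightarrow> (\<Sum>i<n. v i * X $$ (i, j)) = 0"
    and "v (m - 1) = 0" "k < n" "v k \<noteq> 0"
  shows "\<not> controllable X (input_matrix n {m})"
proof
  assume "controllable X (input_matrix n {m})"
  moreover have "0\<^sub>v n \<in> carrier_vec (dim_row X)" "unit_vec n k \<in> carrier_vec (dim_row X)"
    using X by auto
  ultimately obtain T u x where "T > 0" and traj: "trajectory X (input_matrix n {m}) T u x"
    and x0: "x 0 = 0\<^sub>v n" and xT: "x T = unit_vec n k"
    unfolding controllable_def by blast
  let ?f = "\<lambda>i s. vec_index (X *\<^sub>v x s + input_matrix n {m} *\<^sub>v u s) i"
  have "((\<lambda>s. \<Sum>i<n. v i * ?f i s) has_integral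
      (\<Sum>i<n. v i * (vec_index (x T) i - vec_index (x 0) i))) {0..T}"
    using traj X \<open>T > 0\<close> unfolding trajectory_def
    by (intro has_integral_sum has_integral_mult_right) auto
  moreover have "(\<Sum>i<n. v i * ?f i s) = 0" if "s \<in> {0..T}" for s
  proof -
    have "x s \<in> carrier_vec n" "u s \<in> carrier_vec 1"
      using traj X that unfolding trajectory_def by auto
    \<comment> \<open>The input enters only row \<open>m - 1\<close>, where \<open>v\<close>
      vanishes.\<close>
    then have "(\<Sum>i<n. v i * ?f i s)
        = (\<Sum>i<n. v i * (\<Sum>j<n. X $$ (i, j) * vec_index (x s) j))"
      using X \<open>v (m - 1) = 0\<close> by (intro sum.cong) (auto simp only: lessThan_iff single_input_index add_0_right mult_zero_left split: if_split)
    also have "\<dots> = (\<Sum>j<n. (\<Sum>i<n. v i * X $$ (i, j)) * vec_index (x s) j)"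
      unfolding sum_distrib_left sum_distrib_right
      by (subst sum.swap) (simp add: mult.assoc)
    also have "\<dots> = 0" using kernel by simp
    finally show ?thesis .
  qed
  then have "((\<lambda>s. \<Sum>i<n. v i * ?f i s) has_integral 0) {0..T}"
    by (rule has_integral_is_0)
  ultimately have "(\<Sum>i<n. v i * (vec_index (x T) i - vec_index (x 0) i)) = 0"
    by (rule has_integral_unique)
  moreover have "(\<Sum>i<n. v i * (vec_index (x T) i - vec_index (x 0) i))
      = (\<Sum>i<n. if i = k then v i else 0)"
    by (rule sum.cong) (use \<open>k < n\<close> in \<open>auto simp: x0 xT unit_vec_def\<close>)
  ultimately show False using \<open>k < n\<close> \<open>v k \<noteq> 0\<close> by simp
qed

section \<open>Path graphs\<close>

lemma path_edges_iff:
  assumes "i < n" "j < n"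
  shows "{Suc i, Suc j} \<in> path_edges n \<longleftrightarrow> j = Suc i \<or> i = Suc j"
proof
  assume "{Suc i, Suc j} \<in> path_edges n"
  then show "j = Suc i \<or> i = Suc j"
    by (auto simp: path_edges_def doubleton_eq_iff)
next
  assume "j = Suc i \<or> i = Suc j"
  then show "{Suc i, Suc j} \<in> path_edges n"
  proof
    assume "j = Suc i"
    then show ?thesis using assms unfolding path_edges_def
      by (intro CollectI exI[of _ "Suc i"]) auto
  next
    assume "i = Suc j"
    then show ?thesis using assms unfolding path_edges_def
      by (intro CollectI exI[of _ "Suc j"]) auto
  qed
qed

lemma ball_vertices: "(\<forall>i\<in>{Suc 0..n}. P i) \<longleftrightarrow> (\<forall>i<n. P (Suc i))"
proof
  assume *: "\<forall>i<n. P (Suc i)"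
  show "\<forall>i\<in>{Suc 0..n}. P i"
  proof
    fix i assume "i \<in> {Suc 0..n}"
    then obtain k where "i = Suc k" "k < n" by (cases i) auto
    then show "P i" using * by simp
  qed
qed auto

lemma Sym_path_iff:
  "X \<in> Sym n (path_edges n) \<longleftrightarrow> X \<in> carrier_mat n n \<and> (\<forall>i<n. \<forall>j<n. X $$ (i, j) = X $$ (j, i)) \<and>
     (\<forall>i<n. \<forall>j<n. i \<noteq> j \<longrightarrow> (X $$ (i, j) \<noteq> 0 \<longleftrightarrow> j = Suc i \<or> i = Suc j))"
proof -
  have "transpose_mat X = X \<longleftrightarrow> (\<forall>i<n. \<forall>j<n. X $$ (i, j) = X $$ (j, i))"
    if "X \<in> carrier_mat n n"
  proof
    assume "transpose_mat X = X"
    then show "\<forall>i<n. \<forall>j<n. X $$ (i, j) = X $$ (j, i)"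
      using that by (metis carrier_matD index_transpose_mat(1))
  qed (use that in auto)
  then show ?thesis
    by (simp add: Sym_def ball_vertices path_edges_iff cong: conj_cong)
qed

lemma Sym0_path_zero_diag_chain:
  assumes "X \<in> Sym0 n (path_edges n)"
  shows "X \<in> carrier_mat n n" "zero_diag_chain n (\<lambda>i j. X $$ (i, j))"
proof -
  have X: "X \<in> Sym n (path_edges n)" and "\<forall>i<n. X $$ (i, i) = 0"
    using assms by (simp_all add: Sym0_def ball_vertices)
  then show "zero_diag_chain n (\<lambda>i j. X $$ (i, j))"
    unfolding Sym_path_iff zero_diag_chain_def by (metis n_not_Suc_n)
  show "X \<in> carrier_mat n n" using X by (simp add: Sym_path_iff)
qed

text \<open>Hence strong controllability over \<open>Sym0\<close> already yields the driver set
  property.\<close>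

lemma adj_matrix_path_Sym0: "adj_matrix n (path_edges n) \<in> Sym0 n (path_edges n)"
proof -
  \<comment> \<open>A diagonal entry of the adjacency matrix tests a doubleton that collapses to
    this singleton.\<close>
  have "{Suc i} \<notin> path_edges n" if "i < n" for i
    using path_edges_iff[OF that that] by simp
  then show ?thesis
    by (auto simp add: Sym0_def Sym_path_iff ball_vertices adj_matrix_def path_edges_iff)
qed

lemma strongly_controllable_Sym0_path:
  assumes "even n" "n \<ge> 2" "m = 2 \<or> m = n - 1"
  shows "strongly_controllable (Sym0 n (path_edges n)) n {m}"
  unfolding strongly_controllable_def
proof
  fix X assume "X \<in> Sym0 n (path_edges n)"
  note X = Sym0_path_zero_diag_chain[OF this]
  from assms(3) have "poly_steerable n (\<lambda>i j. X $$ (i, j)) (m - 1)"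
  proof
    assume m: "m = n - 1"
    show ?thesis using poly_steerable_second_last[OF X(2) assms(1,2)] by (simp add: m numeral_2_eq_2)
  next
    assume m: "m = 2"
    \<comment> \<open>Vertex \<open>2\<close> has index \<open>1\<close>, which reversal sends to
      \<open>n - 2\<close>.\<close>
    have eq: "n - Suc (m - 1) = n - 2" and "m - 1 < n" using m assms(2) by auto
    show ?thesis
    proof (rule poly_steerable_rev)
      show "poly_steerable n (\<lambda>i j. X $$ (n - Suc i, n - Suc j)) (n - Suc (m - 1))"
        unfolding eq by (rule poly_steerable_second_last[OF zero_diag_chain_rev[OF X(2)] assms(1,2)])
    qed fact
  qed
  with X(1) show "controllable X (input_matrix n {m})" by (rule controllable_if_poly_steerable)
qed

text \<open>
  The diagonal is chosen such that \<open>(1, 0, -1, \<dots>, -1)\<close> lies in the kernel.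
\<close>

definition singular_path :: "nat \<Rightarrow> nat \<Rightarrow> nat \<Rightarrow> real" where
  "singular_path n i j =
     (if j = Suc i \<or> i = Suc j then 1
      else if i \<noteq> j \<or> i \<le> 1 then 0
      else if i = 2 \<or> Suc i = n then -1 else -2)"

definition singular_path_kernel :: "nat \<Rightarrow> real" where
  "singular_path_kernel i = (if i = 0 then 1 else if i = 1 then 0 else -1)"

text \<open>Column \<open>0\<close> meets only zero terms and in column \<open>1\<close> the entries
  \<open>1\<close> and \<open>-1\<close> cancel. On the indices from \<open>2\<close> on, the matrix
  is the negative Laplacian of a path, which annihilates constants; \<open>n \<ge> 4\<close> gives
  that path at least two vertices, so both its ends have degree one.\<close>

lemma singular_path_kernel:
  assumes "n \<ge> 4" "j < n"
  shows "(\<Sum>i<n. singular_path_kernel i * singular_path n i j) = 0"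
proof -
  consider "j = 0" | "j = 1" | "j = 2" | "j > 2" by linarith
  then show ?thesis
    by cases (use assms in \<open>subst sum_neighbours[OF assms(2)];
      auto simp: singular_path_def singular_path_kernel_def\<close>)+
qed

lemma not_strongly_controllable_Sym_path:
  assumes "n \<ge> 4" "m = 2 \<or> m = n - 1"
  shows "\<not> strongly_controllable (Sym n (path_edges n)) n {m}"
  using assms(2)
proof
  assume m: "m = 2"
  define X where "X = Matrix.mat n n (\<lambda>(i, j). singular_path n i j)"
  have "X \<in> Sym n (path_edges n)"
    by (auto simp: Sym_path_iff X_def singular_path_def)
  moreover have "\<not> controllable X (input_matrix n {m})"
    by (rule not_controllable_if_left_kernel[where v = singular_path_kernel and k = 0])
       (use singular_path_kernel[OF assms(1)] assms(1) m in
         \<open>auto simp: X_def singular_path_kernel_def\<close>)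
  ultimately show ?thesis unfolding strongly_controllable_def by blast
next
  assume m: "m = n - 1"
  \<comment> \<open>Reversal moves the zero of the kernel vector from index \<open>1\<close> to
    \<open>n - 2\<close>, the index of vertex \<open>n - 1\<close>.\<close>
  define X where "X = Matrix.mat n n (\<lambda>(i, j). singular_path n (n - Suc i) (n - Suc j))"
  have "X \<in> Sym n (path_edges n)"
    by (auto simp: Sym_path_iff X_def singular_path_def)
  moreover have "\<not> controllable X (input_matrix n {m})"
  proof (rule not_controllable_if_left_kernel[where v = "\<lambda>i. singular_path_kernel (n - Suc i)"
        and k = "n - 1"])
    fix j assume j: "j < n"
    have "(\<Sum>i<n. singular_path_kernel (n - Suc i) * X $$ (i, j))
        = (\<Sum>i<n. singular_path_kernel (n - Suc i) * singular_path n (n - Suc i) (n - Suc j))"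
      using j by (simp add: X_def)
    also have "\<dots> = (\<Sum>i<n. singular_path_kernel i * singular_path n i (n - Suc j))"
      by (rule sum.nat_diff_reindex)
    also have "\<dots> = 0"
      using j assms(1) by (intro singular_path_kernel) auto
    finally show "(\<Sum>i<n. singular_path_kernel (n - Suc i) * X $$ (i, j)) = 0" .
  qed (use assms(1) m in \<open>auto simp: X_def singular_path_kernel_def\<close>)
  ultimately show ?thesis unfolding strongly_controllable_def by blast
qed

text \<open>This makes every singleton driver set minimal.\<close>

lemma driver_set_card_ge_1:
  assumes "driver_set n E S"
  shows "1 \<le> card S"
  using assms finite_subset[of S "{1..n}"]
  by (auto simp: driver_set_def Suc_le_eq card_gt_0_iff)

theorem theorem18:
  fixes n :: nat
  assumes "even n" and "n \<ge> 4"
  shows "minimal_driver_set n (path_edges n) {2} \<and> type_II n (path_edges n) {2} \<and>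
         minimal_driver_set n (path_edges n) {n - 1} \<and> type_II n (path_edges n) {n - 1}"
proof -
  have "minimal_driver_set n (path_edges n) {m} \<and> type_II n (path_edges n) {m}"
    if m: "m = 2 \<or> m = n - 1" for m
  proof -
    have strong: "strongly_controllable (Sym0 n (path_edges n)) n {m}"
      using strongly_controllable_Sym0_path assms m by simp
    then have "driver_set n (path_edges n) {m}"
      using adj_matrix_path_Sym0 m assms(2)
      by (auto simp: driver_set_def strongly_controllable_def)
    then show ?thesis
      using strong not_strongly_controllable_Sym_path[OF assms(2) m]
      by (auto simp: minimal_driver_set_def type_II_def dest: driver_set_card_ge_1)
  qed
  then show ?thesis by blast
qed

end
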